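(* Let $\Gamma$ be a finite connected regular non-complete graph of girth $\mathsf{g}$ and valency at least $3$. Let $G\le \mathrm{Aut}(\Gamma)$ and let $s$ be a positive integer with $2\le s\le \mathrm{diam}(L(\Gamma))+1$. Then $G$ is transitive on the set of $s$-arcs of $\Gamma$ if and only if $s\le \mathsf{g}/2+1$ and $G$ is transitive on the set of $(s-1)$-geodesics of $L(\Gamma)$.
   Context: All graphs are finite, simple and undirected. The girth is the length of a shortest cycle. The line graph $L(\Gamma)$ has vertex set $E(\Gamma)$, two edges being adjacent iff they share a vertex; $G\le\mathrm{Aut}(\Gamma)$ acts on $L(\Gamma)$ via its natural action on edges. An $s$-arc is a walk $(v_0,\ldots,v_s)$ (consecutive vertices adjacent) with $v_{j-1}\ne v_{j+1}$ for $1\le j\le s-1$. For $1\le s\le\mathrm{diam}$, an $s$-geodesic of a graph $X$ is a walk $(x_0,\ldots,x_s)$ with $d_X(x_0,x_s)=s$. *)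

theory Defs
  imports "Graph_Theory.Graph_Theory" "HOL-Algebra.Group_Action"
begin

text \<open>
  A finite simple undirected graph is a \<^locale>\<open>pair_graph\<close>: both orientations
  \<open>(u, v)\<close> and \<open>(v, u)\<close> of an edge belong to \<^const>\<open>parcs\<close>.
\<close>

definition regular :: "'a pair_pre_digraph \<Rightarrow> nat \<Rightarrow> bool" where
  "regular \<Gamma> k \<longleftrightarrow> (\<forall>v \<in> pverts \<Gamma>. out_degree (with_proj \<Gamma>) v = k)"

text \<open>
  In a symmetric digraph \<open>u, v, u\<close> counts as a cycle of the library, hence the bound
  \<open>3 \<le> length p\<close>. The girth of a forest is \<open>\<infinity>\<close>.
\<close>

definition girth :: "'a pair_pre_digraph \<Rightarrow> ereal" where
  "girth \<Gamma> = (INF p \<in> {p. pre_digraph.cycle (with_proj \<Gamma>) p \<and> 3 \<le> length p}. ereal (length p))"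

text \<open>Graph distance is the library's weighted distance with all weights \<open>1\<close>.\<close>

definition gdist :: "'a pair_pre_digraph \<Rightarrow> 'a \<Rightarrow> 'a \<Rightarrow> ereal" where
  "gdist X u v = wf_digraph.\<mu> (with_proj X) (\<lambda>_. 1) u v"

definition diam :: "'a pair_pre_digraph \<Rightarrow> ereal" where
  "diam X = (SUP (u, v) \<in> pverts X \<times> pverts X. gdist X u v)"

definition edges :: "'a pair_pre_digraph \<Rightarrow> 'a set set" where
  "edges \<Gamma> = {{u, v} | u v. (u, v) \<in> parcs \<Gamma>}"

definition line_graph :: "'a pair_pre_digraph \<Rightarrow> 'a set pair_pre_digraph" where
  "line_graph \<Gamma> = \<lparr> pverts = edges \<Gamma>,
     parcs = {(e, f). e \<in> edges \<Gamma> \<and> f \<in> edges \<Gamma> \<and> e \<noteq> f \<and> e \<inter> f \<noteq> {}} \<rparr>"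

text \<open>Walks are given by their vertex lists, so a walk of length \<open>s\<close> is a list of length \<open>s + 1\<close>.\<close>

definition s_arcs :: "'a pair_pre_digraph \<Rightarrow> nat \<Rightarrow> 'a list set" where
  "s_arcs \<Gamma> s = {p. vwalk p (with_proj \<Gamma>) \<and> length p = s + 1 \<and>
     (\<forall>j. 1 \<le> j \<and> j < s \<longrightarrow> p ! (j - 1) \<noteq> p ! (j + 1))}"

definition geodesics :: "'a pair_pre_digraph \<Rightarrow> nat \<Rightarrow> 'a list set" where
  "geodesics X s = {p. vwalk p (with_proj X) \<and> length p = s + 1 \<and> gdist X (p ! 0) (p ! s) = ereal s}"

text \<open>
  As in \<^const>\<open>BijGroup\<close>, automorphisms are functions that are \<^const>\<open>undefined\<close>
  outside the vertex set.
\<close>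

definition aut_group :: "'a pair_pre_digraph \<Rightarrow> ('a \<Rightarrow> 'a) monoid" where
  "aut_group \<Gamma> = BijGroup (pverts \<Gamma>) \<lparr> carrier := {g \<in> Bij (pverts \<Gamma>).
     \<forall>u \<in> pverts \<Gamma>. \<forall>v \<in> pverts \<Gamma>. (g u, g v) \<in> parcs \<Gamma> \<longleftrightarrow> (u, v) \<in> parcs \<Gamma>} \<rparr>"

definition arc_transitive :: "'a pair_pre_digraph \<Rightarrow> ('a \<Rightarrow> 'a) set \<Rightarrow> nat \<Rightarrow> bool" where
  "arc_transitive \<Gamma> G s \<longleftrightarrow>
     transitive_action (aut_group \<Gamma> \<lparr> carrier := G \<rparr>) (s_arcs \<Gamma> s)
       (\<lambda>g. \<lambda>p \<in> s_arcs \<Gamma> s. map g p)"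

text \<open>
  Here \<open>G\<close> consists of automorphisms of \<open>\<Gamma>\<close>, acting on an edge \<open>e\<close>, i.e. on a vertex of the
  line graph, by \<open>e \<mapsto> g ` e\<close>.
\<close>

definition line_geodesic_transitive :: "'a pair_pre_digraph \<Rightarrow> ('a \<Rightarrow> 'a) set \<Rightarrow> nat \<Rightarrow> bool" where
  "line_geodesic_transitive \<Gamma> G s \<longleftrightarrow>
     transitive_action (aut_group \<Gamma> \<lparr> carrier := G \<rparr>) (geodesics (line_graph \<Gamma>) s)
       (\<lambda>g. \<lambda>p \<in> geodesics (line_graph \<Gamma>) s. map (\<lambda>e. g ` e) p)"

end

theory Submission
  imports Defs
begin

text \<open>
  Sending an \<open>s\<close>-arc to its sequence of edges is an injective equivariant map into the walks of length
  \<open>s - 1\<close> of the line graph (\<open>s \<ge> 2\<close>), and every \<open>(s - 1)\<close>-geodesic of the line graph is in its image.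
  If \<open>2s - 2\<close> is at most the girth, then all values are geodesics: a shorter path between the two end
  edges would give two arcs of different lengths between the same two vertices, of total length
  at most \<open>2s - 3\<close>, and hence a cycle shorter than the girth. So the map is an equivariant bijection.
  Conversely, the diameter hypothesis provides at least one \<open>(s - 1)\<close>-geodesic, so transitivity on \<open>s\<close>-arcs
  forces all edge sequences of \<open>s\<close>-arcs to be geodesics; winding around a cycle of length less than
  \<open>2s - 2\<close> gives one that is not.
\<close>

section \<open>Nonbacktracking walks and short cycles\<close>

text \<open>A walk is a function on the naturals of which only the values at \<open>0\<close> to
  \<open>n\<close> matter, so that shifting, reversing and gluing walks become index arithmetic. For
  \<open>n = 0\<close> nothing is required of \<open>f 0\<close>.\<close>

definition nonbacktracking :: "'a rel \<Rightarrow> nat \<Rightarrow> (nat \<Rightarrow> 'a) \<Rightarrow> bool" where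
  "nonbacktracking E n f \<longleftrightarrow> (\<forall>i<n. (f i, f (Suc i)) \<in> E) \<and> (\<forall>i. Suc i < n \<longrightarrow> f i \<noteq> f (Suc (Suc i)))"

text \<open>For \<open>3 \<le> n\<close> this is a cycle of length \<open>n\<close>. For
  \<open>n = 2\<close> an edge traversed back and forth also satisfies it in a symmetric relation,
  which is why its uses come with the bound \<open>3 \<le> n\<close>.\<close>

definition cyclic_walk :: "'a rel \<Rightarrow> nat \<Rightarrow> (nat \<Rightarrow> 'a) \<Rightarrow> bool" where
  "cyclic_walk E n f \<longleftrightarrow> f n = f 0 \<and> inj_on f {..<n} \<and> (\<forall>i<n. (f i, f (Suc i)) \<in> E)"

text \<open>Choose a repeated value whose two positions have the least possible gap
  \<open>d\<close>. Minimality makes the \<open>d\<close> values in between distinct;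
  \<open>d = 1\<close> would be a loop and \<open>d = 2\<close> an immediate reversal.\<close>

lemma nonbacktracking_repeat_imp_cyclic_walk:
  assumes nb: "nonbacktracking E n f" and "irrefl E" and rep: "i < j" "j \<le> n" "f i = f j"
  shows "\<exists>m g. 3 \<le> m \<and> m \<le> n \<and> cyclic_walk E m g"
proof -
  define P where "P d \<longleftrightarrow> 0 < d \<and> (\<exists>i. i + d \<le> n \<and> f i = f (i + d))" for d
  define d where "d = (LEAST d. P d)"
  have "P (j - i)" using rep unfolding P_def by (auto intro!: exI[of _ i])
  then have "P d" unfolding d_def by (rule LeastI)
  have least: "\<not> P d'" if "d' < d" for d' using that not_less_Least unfolding d_def by blast
  obtain k where k: "k + d \<le> n" "f k = f (k + d)" and "0 < d" using \<open>P d\<close> unfolding P_def by auto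
  have "d \<noteq> 1"
  proof
    assume "d = 1"
    then have "(f k, f k) \<in> E" using nb k unfolding nonbacktracking_def by (metis Suc_eq_plus1 Suc_le_eq)
    then show False using \<open>irrefl E\<close> by (auto simp: irrefl_def)
  qed
  moreover have "d \<noteq> 2" using nb k unfolding nonbacktracking_def by auto
  ultimately have "3 \<le> d" using \<open>0 < d\<close> by linarith
  have ne: "f (k + a) \<noteq> f (k + b)" if "a < b" "b < d" for a b
  proof
    assume "f (k + a) = f (k + b)"
    then have "P (b - a)" using that k unfolding P_def by (auto intro!: exI[of _ "k + a"])
    then show False using least[of "b - a"] that by simp
  qed
  have "inj_on (\<lambda>i. f (k + i)) {..<d}"
    by (rule inj_onI) (metis ne lessThan_iff linorder_neqE_nat)
  then have "cyclic_walk E d (\<lambda>i. f (k + i))"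
    using nb k unfolding cyclic_walk_def nonbacktracking_def by auto
  then show ?thesis using \<open>3 \<le> d\<close> k(1) by (metis le_add2 le_trans)
qed

text \<open>Cut off the last steps of both walks as long as they agree. Where they first differ,
  going along \<open>f\<close> and back along \<open>g\<close> is a closed nonbacktracking walk,
  which contains a cycle of length at most \<open>a + b\<close>. If one walk is used up first, the
  rest of the other is such a closed walk by itself.\<close>

lemma nonbacktracking_length_unique:
  assumes E: "sym E" "irrefl E"
    and "nonbacktracking E a f" "nonbacktracking E b g" "f 0 = g 0" "f a = g b"
    and "\<And>m h. 3 \<le> m \<Longrightarrow> m \<le> a + b \<Longrightarrow> \<not> cyclic_walk E m h"
  shows "a = b"
  using assms(3-)
proof (induction a arbitrary: b)
  case 0
  then show ?case using nonbacktracking_repeat_imp_cyclic_walk[OF 0(2) E(2), of 0 b] by fastforce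
next
  case (Suc a c)
  note f = Suc.prems(1) and g = Suc.prems(2)
  show ?case
  proof (cases c)
    case 0
    then show ?thesis
      using nonbacktracking_repeat_imp_cyclic_walk[OF f E(2), of 0 "Suc a"] Suc.prems(3-) by fastforce
  next
    case c: (Suc b)
    show ?thesis
    proof (cases "f a = g b")
      case True
      have "nonbacktracking E a f" "nonbacktracking E b g" using f g c unfolding nonbacktracking_def by auto
      then show ?thesis using Suc.IH[of b] True Suc.prems(3,5) c by simp
    next
      case False
      \<comment> \<open>\<open>h\<close> follows \<open>f\<close> up to the common endpoint at index
        \<open>Suc a\<close>, then \<open>g\<close> in reverse. Both descriptions agree at
        \<open>Suc a\<close>, as \<open>hg\<close> records.\<close>
      define h where "h i = (if i \<le> Suc a then f i else g (Suc a + Suc b - i))" for i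
      have hg: "h i = g (Suc a + Suc b - i)" if "Suc a \<le> i" for i
        using that Suc.prems(4) c by (cases "i = Suc a") (auto simp: h_def)
      have step: "(h i, h (Suc i)) \<in> E" if "i < Suc a + Suc b" for i
      proof (cases "i < Suc a")
        case True
        then show ?thesis using f by (auto simp: h_def nonbacktracking_def)
      next
        case False
        define t where "t = a + Suc b - i"
        have t: "t < Suc b" "h i = g (Suc t)" "h (Suc i) = g t"
          using False that by (auto simp: hg t_def Suc_diff_le)
        then have "(g t, g (Suc t)) \<in> E" using g c unfolding nonbacktracking_def by blast
        then show ?thesis using t E(1) by (auto dest: symD)
      qed
      have turn: "h i \<noteq> h (Suc (Suc i))" if "Suc i < Suc a + Suc b" for i
      proof -
        \<comment> \<open>Inside \<open>f\<close>, across the junction, inside the reversed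
          \<open>g\<close>. At the junction the neighbours of the common endpoint are
          \<open>f a\<close> and \<open>g b\<close>, distinct by the case assumption.\<close>
        consider "Suc i < Suc a" | "i = a" | "Suc a \<le> i" by linarith
        then show ?thesis
        proof cases
          case 1
          then show ?thesis using f by (auto simp: h_def nonbacktracking_def)
        next
          case 2
          then show ?thesis using False by (simp add: h_def)
        next
          case 3
          define t where "t = a + b - i"
          have t: "Suc t < Suc b" "h i = g (Suc (Suc t))" "h (Suc (Suc i)) = g t"
            using 3 that by (auto simp: hg t_def Suc_diff_le)
          then show ?thesis using g c unfolding nonbacktracking_def by metis
        qed
      qed
      have "nonbacktracking E (Suc a + Suc b) h" using step turn unfolding nonbacktracking_def by blast
      \<comment> \<open>The closed walk may still backtrack at its base point, which is harmless:
        only a repeated value is needed.\<close>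
      moreover have "h 0 = h (Suc a + Suc b)"
        using Suc.prems(3) by (simp add: h_def)
      ultimately show ?thesis
        using nonbacktracking_repeat_imp_cyclic_walk[OF _ E(2), of "Suc a + Suc b" h 0 "Suc a + Suc b"]
          Suc.prems(5) c by (metis le_refl zero_less_Suc add_Suc)
    qed
  qed
qed

text \<open>Append the steps one at a time; a step that would return to the last but one vertex
  instead cancels the previous step, so the length never exceeds \<open>m\<close>.\<close>

lemma relpow_imp_nonbacktracking:
  assumes "(u, w) \<in> E ^^ m"
  shows "\<exists>n f. n \<le> m \<and> nonbacktracking E n f \<and> f 0 = u \<and> f n = w"
  using assms
proof (induction m arbitrary: w)
  case 0
  then show ?case by (auto simp: nonbacktracking_def intro!: exI[of _ "\<lambda>_. u"])
next
  case (Suc m)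
  then obtain v where "(u, v) \<in> E ^^ m" and vw: "(v, w) \<in> E" by auto
  then obtain n f where f: "n \<le> m" "nonbacktracking E n f" "f 0 = u" "f n = v" using Suc.IH by blast
  show ?case
  proof (cases "0 < n \<and> f (n - 1) = w")
    case True
    then show ?thesis using f by (intro exI[of _ "n - 1"] exI[of _ f]) (auto simp: nonbacktracking_def)
  next
    case False
    have "nonbacktracking E (Suc n) (f(Suc n := w))"
      using f False vw unfolding nonbacktracking_def by (auto simp: less_Suc_eq)
    then show ?thesis using f by (metis Suc_le_mono fun_upd_same fun_upd_apply nat.distinct(1))
  qed
qed

section \<open>Distance through powers of the arc relation\<close>

text \<open>Replaces arc lists by relation powers. The vertex condition on \<open>u\<close> matters
  for \<open>n = 0\<close>, where the relation power is the identity on the whole type.\<close>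

lemma (in pair_wf_digraph) awalk_length_iff_relpow:
  "(\<exists>p. awalk u p v \<and> length p = n) \<longleftrightarrow> u \<in> pverts G \<and> (u, v) \<in> parcs G ^^ n"
proof (induction n arbitrary: u)
  case 0
  then show ?case by (auto simp: awalk_Nil_iff)
next
  case (Suc n)
  have "(\<exists>p. awalk u p v \<and> length p = Suc n) \<longleftrightarrow>
      (\<exists>w. (u, w) \<in> parcs G \<and> (\<exists>p. awalk w p v \<and> length p = n))"
  proof
    assume "\<exists>p. awalk u p v \<and> length p = Suc n"
    then obtain e p where p: "awalk u (e # p) v" "length p = n" by (auto simp: length_Suc_conv)
    then have "(u, snd e) \<in> parcs G" "awalk (snd e) p v" by (auto simp: awalk_Cons_iff)
    then show "\<exists>w. (u, w) \<in> parcs G \<and> (\<exists>p. awalk w p v \<and> length p = n)"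
      using p(2) by blast
  next
    assume "\<exists>w. (u, w) \<in> parcs G \<and> (\<exists>p. awalk w p v \<and> length p = n)"
    then obtain w p where "(u, w) \<in> parcs G" "awalk w p v" "length p = n" by blast
    then show "\<exists>p. awalk u p v \<and> length p = Suc n"
      by (intro exI[of _ "(u, w) # p"]) (simp add: awalk_Cons_iff)
  qed
  also have "\<dots> \<longleftrightarrow> u \<in> pverts G \<and> (u, v) \<in> parcs G ^^ Suc n"
    unfolding Suc.IH
    by (blast dest: in_arcsD1 in_arcsD2 relpow_Suc_D2 intro: relpow_Suc_I2)
  finally show ?case .
qed

lemma (in pair_wf_digraph) gdist_conv_INF:
  "gdist G u v = (INF p\<in>{p. awalk u p v}. ereal (length p))"
proof -
  have "awalk_cost (\<lambda>_. 1) p = real (length p)" for p by (induction p) auto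
  then show ?thesis unfolding gdist_def \<mu>_def by simp
qed

lemma (in pair_wf_digraph) gdist_le_iff:
  fixes n :: nat
  assumes "u \<in> pverts G"
  shows "gdist G u v \<le> ereal n \<longleftrightarrow> (\<exists>m\<le>n. (u, v) \<in> parcs G ^^ m)"
proof
  assume "gdist G u v \<le> ereal n"
  \<comment> \<open>A strict bound on the infimum yields an actual walk, and being shorter than
    \<open>Suc n\<close> means having length at most \<open>n\<close>.\<close>
  then have "gdist G u v < ereal (Suc n)" by (rule order_le_less_trans) simp
  then obtain p where "awalk u p v" "length p \<le> n"
    unfolding gdist_conv_INF by (auto simp: INF_less_iff)
  then show "\<exists>m\<le>n. (u, v) \<in> parcs G ^^ m" using awalk_length_iff_relpow by blast
next
  assume "\<exists>m\<le>n. (u, v) \<in> parcs G ^^ m"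
  then obtain m where m: "m \<le> n" "(u, v) \<in> parcs G ^^ m" by blast
  then obtain p where "awalk u p v" "length p = m" using awalk_length_iff_relpow[of u v m] assms by blast
  then show "gdist G u v \<le> ereal n"
    unfolding gdist_conv_INF by (intro INF_lower2[of p]) (use m in auto)
qed

lemma (in pair_wf_digraph) gdist_eq_iff:
  fixes n :: nat
  assumes "u \<in> pverts G"
  shows "gdist G u v = ereal n \<longleftrightarrow> (u, v) \<in> parcs G ^^ n \<and> (\<forall>m<n. (u, v) \<notin> parcs G ^^ m)"
proof -
  have "ereal n \<le> gdist G u v \<longleftrightarrow> (\<forall>m<n. (u, v) \<notin> parcs G ^^ m)"
  proof
    assume *: "ereal n \<le> gdist G u v"
    show "\<forall>m<n. (u, v) \<notin> parcs G ^^ m"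
    proof (intro allI impI notI)
      fix m assume "m < n" "(u, v) \<in> parcs G ^^ m"
      then have "gdist G u v \<le> ereal m" using gdist_le_iff[OF assms] by blast
      with * have "ereal n \<le> ereal m" by (rule order_trans)
      then show False using \<open>m < n\<close> by simp
    qed
  next
    assume *: "\<forall>m<n. (u, v) \<notin> parcs G ^^ m"
    have "n \<le> length p" if "awalk u p v" for p
      using that * awalk_length_iff_relpow[of u v "length p"] by (metis not_le)
    then show "ereal n \<le> gdist G u v"
      unfolding gdist_conv_INF by (intro INF_greatest) simp
  qed
  moreover have "(\<exists>m\<le>n. (u, v) \<in> parcs G ^^ m) \<and> (\<forall>m<n. (u, v) \<notin> parcs G ^^ m) \<longleftrightarrow>
      (u, v) \<in> parcs G ^^ n \<and> (\<forall>m<n. (u, v) \<notin> parcs G ^^ m)"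
    by (auto simp: le_less)
  ultimately show ?thesis using gdist_le_iff[OF assms, of v n] unfolding order_eq_iff[of "gdist G u v"] by argo
qed

lemma (in pair_wf_digraph) vwalk_conv_nth:
  "vwalk p (with_proj G) \<longleftrightarrow> p \<noteq> [] \<and> hd p \<in> pverts G \<and> (\<forall>i. Suc i < length p \<longrightarrow> (p ! i, p ! Suc i) \<in> parcs G)"
proof (induction p rule: vwalk_arcs.induct)
  case (3 x y xs)
  have "vwalk (x # y # xs) (with_proj G) \<longleftrightarrow> (x, y) \<in> parcs G \<and> vwalk (y # xs) (with_proj G)"
    by (metis in_arcsD1 vwalk_Cons_Cons with_proj_simps(3))
  then show ?case unfolding 3 by (auto simp: nth_Cons' All_less_Suc2 dest: in_arcsD1 in_arcsD2)
qed (auto simp: vwalk_def)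

section \<open>Group actions and the automorphism group\<close>

text \<open>Bijectivity on \<open>E\<close> comes for free: the inverse group element acts as the
  inverse map.\<close>

lemma (in group) group_actionI:
  assumes closed: "\<And>g x. g \<in> carrier G \<Longrightarrow> x \<in> E \<Longrightarrow> \<phi> g x \<in> E"
    and mult: "\<And>g h x. g \<in> carrier G \<Longrightarrow> h \<in> carrier G \<Longrightarrow> x \<in> E \<Longrightarrow> \<phi> (g \<otimes> h) x = \<phi> g (\<phi> h x)"
    and one: "\<And>x. x \<in> E \<Longrightarrow> \<phi> \<one> x = x"
  shows "group_action G E (\<lambda>g. \<lambda>x\<in>E. \<phi> g x)"
proof -
  have Bij: "(\<lambda>x\<in>E. \<phi> g x) \<in> Bij E" if g: "g \<in> carrier G" for g
  proof -
    have "bij_betw (\<lambda>x\<in>E. \<phi> g x) E E"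
    proof (rule bij_betw_byWitness[where f' = "\<phi> (inv g)"])
      show "\<forall>x\<in>E. \<phi> (inv g) ((\<lambda>x\<in>E. \<phi> g x) x) = x"
        using g by (simp add: mult[symmetric] one)
      show "\<forall>x\<in>E. (\<lambda>x\<in>E. \<phi> g x) (\<phi> (inv g) x) = x"
        using g by (simp add: mult[symmetric] one closed)
    qed (use g closed in auto)
    then show ?thesis by (simp add: Bij_def)
  qed
  have "(\<lambda>g. \<lambda>x\<in>E. \<phi> g x) \<in> hom G (BijGroup E)"
  proof (rule homI)
    fix g h assume gh: "g \<in> carrier G" "h \<in> carrier G"
    then show "(\<lambda>x\<in>E. \<phi> (g \<otimes> h) x) = (\<lambda>x\<in>E. \<phi> g x) \<otimes>\<^bsub>BijGroup E\<^esub> (\<lambda>x\<in>E. \<phi> h x)"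
      using Bij by (auto simp: BijGroup_def compose_def mult closed fun_eq_iff)
  qed (simp add: BijGroup_def Bij)
  then show ?thesis
    by (intro group_action.intro group_hom.intro group_hom_axioms.intro group_axioms group_BijGroup)
qed

lemma (in group) transitive_action_iff:
  assumes "\<And>g x. g \<in> carrier G \<Longrightarrow> x \<in> E \<Longrightarrow> \<phi> g x \<in> E"
    and "\<And>g h x. g \<in> carrier G \<Longrightarrow> h \<in> carrier G \<Longrightarrow> x \<in> E \<Longrightarrow> \<phi> (g \<otimes> h) x = \<phi> g (\<phi> h x)"
    and "\<And>x. x \<in> E \<Longrightarrow> \<phi> \<one> x = x"
  shows "transitive_action G E (\<lambda>g. \<lambda>x\<in>E. \<phi> g x) \<longleftrightarrow> (\<forall>x\<in>E. \<forall>y\<in>E. \<exists>g\<in>carrier G. \<phi> g x = y)"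
  using group_actionI[of E \<phi>, OF assms]
  unfolding transitive_action_def transitive_action_axioms_def by auto

lemma carrier_aut_group:
  "g \<in> carrier (aut_group \<Gamma>) \<longleftrightarrow> g \<in> Bij (pverts \<Gamma>) \<and>
    (\<forall>u \<in> pverts \<Gamma>. \<forall>v \<in> pverts \<Gamma>. (g u, g v) \<in> parcs \<Gamma> \<longleftrightarrow> (u, v) \<in> parcs \<Gamma>)"
  by (simp add: aut_group_def)

lemma mult_aut_group:
  "g \<in> carrier (aut_group \<Gamma>) \<Longrightarrow> h \<in> carrier (aut_group \<Gamma>) \<Longrightarrow>
    g \<otimes>\<^bsub>aut_group \<Gamma>\<^esub> h = compose (pverts \<Gamma>) g h"
  by (simp add: aut_group_def BijGroup_def)

lemma one_aut_group: "\<one>\<^bsub>aut_group \<Gamma>\<^esub> = (\<lambda>x\<in>pverts \<Gamma>. x)"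
  by (simp add: aut_group_def BijGroup_def)

lemma aut_in_pverts: "g \<in> carrier (aut_group \<Gamma>) \<Longrightarrow> v \<in> pverts \<Gamma> \<Longrightarrow> g v \<in> pverts \<Gamma>"
  by (auto simp: carrier_aut_group dest: Bij_imp_funcset)

lemma group_aut_group: "group (aut_group \<Gamma>)"
proof -
  let ?A = "carrier (aut_group \<Gamma>)" and ?V = "pverts \<Gamma>"
  have "subgroup ?A (BijGroup ?V)"
  proof
    show "?A \<subseteq> carrier (BijGroup ?V)" by (auto simp: carrier_aut_group BijGroup_def)
  next
    fix g h assume gh: "g \<in> ?A" "h \<in> ?A"
    then have "g \<otimes>\<^bsub>BijGroup ?V\<^esub> h = compose ?V g h"
      by (simp add: carrier_aut_group BijGroup_def)
    then show "g \<otimes>\<^bsub>BijGroup ?V\<^esub> h \<in> ?A"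
      using gh aut_in_pverts[OF gh(2)] by (simp add: carrier_aut_group compose_Bij compose_eq)
  next
    show "\<one>\<^bsub>BijGroup ?V\<^esub> \<in> ?A" by (simp add: carrier_aut_group BijGroup_def id_Bij)
  next
    fix g assume g: "g \<in> ?A"
    then have B: "g \<in> Bij ?V" by (simp add: carrier_aut_group)
    have "g (inv_into ?V g v) = v" "inv_into ?V g v \<in> ?V" if "v \<in> ?V" for v
      using B that by (auto simp: Bij_def bij_betw_def f_inv_into_f inv_into_into)
    then have "(inv_into ?V g u, inv_into ?V g v) \<in> parcs \<Gamma> \<longleftrightarrow> (u, v) \<in> parcs \<Gamma>"
      if "u \<in> ?V" "v \<in> ?V" for u v
      using g that unfolding carrier_aut_group by metis
    then show "inv\<^bsub>BijGroup ?V\<^esub> g \<in> ?A"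
      by (simp add: carrier_aut_group inv_BijGroup[OF B] restrict_inv_into_Bij[OF B])
  qed
  then have "group (BijGroup ?V \<lparr>carrier := ?A\<rparr>)"
    using group_BijGroup subgroup.subgroup_is_group by blast
  then show ?thesis by (simp add: aut_group_def)
qed

text \<open>Serves to carry shortcuts in an image back to the original, since preservation of walks
  is shown in the forward direction only.\<close>

lemma aut_inverse:
  assumes "g \<in> carrier (aut_group \<Gamma>)"
  obtains h where "h \<in> carrier (aut_group \<Gamma>)" "\<And>v. v \<in> pverts \<Gamma> \<Longrightarrow> h (g v) = v"
proof -
  interpret A: group "aut_group \<Gamma>" by (rule group_aut_group)
  let ?h = "inv\<^bsub>aut_group \<Gamma>\<^esub> g"
  have "compose (pverts \<Gamma>) ?h g = (\<lambda>x\<in>pverts \<Gamma>. x)"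
    using A.l_inv[OF assms] assms by (simp add: mult_aut_group one_aut_group)
  then have "?h (g v) = v" if "v \<in> pverts \<Gamma>" for v
    using that by (metis compose_eq restrict_apply')
  then show ?thesis using that assms by blast
qed

text \<open>Common to the actions on arcs and on line graph geodesics. The laws are asked for in
  terms of \<open>compose\<close> and the restricted identity, the concrete product and unit of
  \<open>aut_group\<close>.\<close>

lemma transitive_aut_action_iff:
  assumes G: "subgroup G (aut_group \<Gamma>)"
    and closed: "\<And>g x. g \<in> carrier (aut_group \<Gamma>) \<Longrightarrow> x \<in> E \<Longrightarrow> \<phi> g x \<in> E"
    and mult: "\<And>g h x. g \<in> carrier (aut_group \<Gamma>) \<Longrightarrow> h \<in> carrier (aut_group \<Gamma>) \<Longrightarrow> x \<in> E \<Longrightarrow>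
      \<phi> (compose (pverts \<Gamma>) g h) x = \<phi> g (\<phi> h x)"
    and one: "\<And>x. x \<in> E \<Longrightarrow> \<phi> (\<lambda>v\<in>pverts \<Gamma>. v) x = x"
  shows "transitive_action (aut_group \<Gamma> \<lparr> carrier := G \<rparr>) E (\<lambda>g. \<lambda>x\<in>E. \<phi> g x) \<longleftrightarrow>
    (\<forall>x\<in>E. \<forall>y\<in>E. \<exists>g\<in>G. \<phi> g x = y)"
proof -
  have sub: "g \<in> carrier (aut_group \<Gamma>)" if "g \<in> G" for g using G that by (rule subgroup.mem_carrier)
  interpret H: group "aut_group \<Gamma> \<lparr> carrier := G \<rparr>"
    using G group_aut_group by (rule subgroup.subgroup_is_group)
  show ?thesis
    using H.transitive_action_iff[of E \<phi>] closed mult one sub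
    by (simp add: mult_aut_group one_aut_group)
qed

section \<open>Edge sequences and walks in the line graph\<close>

definition edge_walk :: "'a list \<Rightarrow> 'a set list" where
  "edge_walk p = map (\<lambda>i. {p ! i, p ! Suc i}) [0..<length p - 1]"

lemma length_edge_walk [simp]: "length (edge_walk p) = length p - 1"
  by (simp add: edge_walk_def)

lemma nth_edge_walk [simp]: "Suc i < length p \<Longrightarrow> edge_walk p ! i = {p ! i, p ! Suc i}"
  by (simp add: edge_walk_def less_diff_conv)

lemma edge_walk_map: "edge_walk (map g p) = map ((`) g) (edge_walk p)"
  by (simp add: edge_walk_def)

lemma pverts_line_graph [simp]: "pverts (line_graph \<Gamma>) = edges \<Gamma>"
  by (simp add: line_graph_def)

lemma parcs_line_graph:
  "(e, f) \<in> parcs (line_graph \<Gamma>) \<longleftrightarrow> e \<in> edges \<Gamma> \<and> f \<in> edges \<Gamma> \<and> e \<noteq> f \<and> e \<inter> f \<noteq> {}"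
  by (simp add: line_graph_def)

lemma pair_wf_digraph_line_graph: "pair_wf_digraph (line_graph \<Gamma>)"
  by unfold_locales (auto simp: line_graph_def)

lemma edge_imp_relpow_le_1:
  assumes "e \<in> edges \<Gamma>" "f \<in> edges \<Gamma>" "x \<in> e" "x \<in> f"
  shows "\<exists>j\<le>1. (e, f) \<in> parcs (line_graph \<Gamma>) ^^ j"
proof (cases "e = f")
  case True
  then show ?thesis by (intro exI[of _ 0]) simp
next
  case False
  then show ?thesis using assms by (intro exI[of _ 1]) (auto simp: parcs_line_graph)
qed

text \<open>The edge \<open>e\<close>, the \<open>m\<close> edges of the walk and \<open>f\<close>
  form a sequence in which neighbours share a vertex; equal neighbours cost no step, hence at most
  \<open>Suc m\<close> steps.\<close>

lemma line_graph_relpow_upper: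
  assumes "(u, w) \<in> parcs \<Gamma> ^^ m" "e \<in> edges \<Gamma>" "f \<in> edges \<Gamma>" "u \<in> e" "w \<in> f"
  shows "\<exists>j\<le>Suc m. (e, f) \<in> parcs (line_graph \<Gamma>) ^^ j"
  using assms(1,3,5)
proof (induction m arbitrary: w f)
  case 0
  then show ?case using edge_imp_relpow_le_1[of e \<Gamma> f u] assms by simp
next
  case (Suc m)
  then obtain v where v: "(u, v) \<in> parcs \<Gamma> ^^ m" "(v, w) \<in> parcs \<Gamma>" by auto
  then have vw: "{v, w} \<in> edges \<Gamma>" unfolding edges_def by blast
  obtain i where "i \<le> Suc m" "(e, {v, w}) \<in> parcs (line_graph \<Gamma>) ^^ i"
    using Suc.IH[OF v(1) vw] by auto
  moreover obtain j where "j \<le> 1" "({v, w}, f) \<in> parcs (line_graph \<Gamma>) ^^ j"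
    using edge_imp_relpow_le_1[OF vw Suc.prems(2), of w] Suc.prems(3) by auto
  ultimately show ?case by (intro exI[of _ "i + j"]) (auto intro: relpow_trans)
qed

text \<open>Pick a shared vertex for each of the \<open>j\<close> steps. Two successive ones lie in
  a common edge, so they are equal or adjacent, and \<open>j\<close> vertices are joined by at most
  \<open>j - 1\<close> steps. For \<open>j = 0\<close> the subtraction truncates and one end of
  \<open>e = f\<close> serves as both \<open>u\<close> and \<open>w\<close>.\<close>

lemma line_graph_relpow_lower:
  assumes "(e, f) \<in> parcs (line_graph \<Gamma>) ^^ j" "e \<in> edges \<Gamma>" "sym (parcs \<Gamma>)"
  shows "\<exists>u\<in>e. \<exists>w\<in>f. \<exists>m\<le>j - 1. (u, w) \<in> parcs \<Gamma> ^^ m"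
  using assms(1)
proof (induction j arbitrary: f)
  case 0
  then show ?case using assms(2) by (auto simp: edges_def intro!: exI[of _ 0])
next
  case (Suc j)
  then obtain f' where f': "(e, f') \<in> parcs (line_graph \<Gamma>) ^^ j" "(f', f) \<in> parcs (line_graph \<Gamma>)"
    by auto
  then obtain x where x: "x \<in> f'" "x \<in> f" and "f' \<in> edges \<Gamma>" by (auto simp: parcs_line_graph)
  show ?case
  proof (cases j)
    case 0
    then show ?thesis using f' x by (auto intro!: bexI[of _ x] exI[of _ 0])
  next
    case (Suc i)
    obtain u w m where m: "u \<in> e" "w \<in> f'" "m \<le> j - 1" "(u, w) \<in> parcs \<Gamma> ^^ m"
      using Suc.IH[OF f'(1)] by blast
    have "w = x \<or> (w, x) \<in> parcs \<Gamma>"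
      using \<open>f' \<in> edges \<Gamma>\<close> m(2) x(1) assms(3) by (auto simp: edges_def dest: symD)
    then show ?thesis
    proof
      assume "w = x"
      then show ?thesis using m x(2) by (metis diff_le_self diff_Suc_1 le_trans)
    next
      assume "(w, x) \<in> parcs \<Gamma>"
      then have "(u, x) \<in> parcs \<Gamma> ^^ Suc m" using m(4) by auto
      moreover have "Suc m \<le> Suc j - 1" using m(3) Suc by simp
      ultimately show ?thesis using m(1) x(2) by blast
    qed
  qed
qed

section \<open>Arcs and geodesics by index\<close>

text \<open>With at least one step, membership of the first vertex in the graph follows from the
  first arc; for \<open>s = 0\<close> it would be lost.\<close>

lemma (in pair_wf_digraph) s_arcs_iff:
  assumes "1 \<le> s"
  shows "p \<in> s_arcs G s \<longleftrightarrow> length p = Suc s \<and> nonbacktracking (parcs G) s ((!) p)"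
proof -
  have "(\<forall>j. 1 \<le> j \<and> j < s \<longrightarrow> p ! (j - 1) \<noteq> p ! (j + 1)) \<longleftrightarrow>
      (\<forall>i. Suc i < s \<longrightarrow> p ! i \<noteq> p ! Suc (Suc i))"
  proof (intro iffI allI impI)
    fix j assume *: "\<forall>i. Suc i < s \<longrightarrow> p ! i \<noteq> p ! Suc (Suc i)" and "1 \<le> j \<and> j < s"
    then show "p ! (j - 1) \<noteq> p ! (j + 1)" using *[rule_format, of "j - 1"] by simp
  next
    fix i assume *: "\<forall>j. 1 \<le> j \<and> j < s \<longrightarrow> p ! (j - 1) \<noteq> p ! (j + 1)" and "Suc i < s"
    then show "p ! i \<noteq> p ! Suc (Suc i)" using *[rule_format, of "Suc i"] by simp
  qed
  moreover have "hd p \<in> pverts G" if "length p = Suc s" "(p ! 0, p ! Suc 0) \<in> parcs G"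
    using that in_arcsD1 by (cases p) auto
  ultimately show ?thesis
    using assms unfolding s_arcs_def vwalk_conv_nth nonbacktracking_def
    by (auto simp: Suc_le_eq)
qed

text \<open>The walk itself bounds the distance by \<open>t\<close>, so only the absence of shorter
  walks remains to be required.\<close>

lemma (in pair_wf_digraph) geodesics_iff:
  "w \<in> geodesics G t \<longleftrightarrow> length w = Suc t \<and> hd w \<in> pverts G \<and>
    (\<forall>i<t. (w ! i, w ! Suc i) \<in> parcs G) \<and> (\<forall>m<t. (w ! 0, w ! t) \<notin> parcs G ^^ m)"
proof (cases "length w = Suc t \<and> hd w \<in> pverts G")
  case True
  then have "w ! 0 \<in> pverts G" by (cases w) auto
  moreover have "(w ! 0, w ! t) \<in> parcs G ^^ t" if "\<forall>i<t. (w ! i, w ! Suc i) \<in> parcs G"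
    using that unfolding relpow_fun_conv by (intro exI[of _ "(!) w"]) simp
  ultimately show ?thesis
    using True unfolding geodesics_def vwalk_conv_nth by (auto simp: gdist_eq_iff)
next
  case False
  then show ?thesis unfolding geodesics_def vwalk_conv_nth by auto
qed

text \<open>A shortcut between two intermediate vertices could be spliced in and would shorten the
  whole geodesic.\<close>

lemma (in pair_wf_digraph) geodesic_relpow_lower:
  assumes w: "w \<in> geodesics G t" and ij: "i \<le> j" "j \<le> t" and m: "(w ! i, w ! j) \<in> parcs G ^^ m"
  shows "j - i \<le> m"
proof (rule ccontr)
  have step: "(w ! a, w ! (a + b)) \<in> parcs G ^^ b" if "a + b \<le> t" for a b
    using w that unfolding geodesics_iff relpow_fun_conv
    by (intro exI[of _ "\<lambda>k. w ! (a + k)"]) auto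
  have "(w ! 0, w ! i) \<in> parcs G ^^ i" "(w ! j, w ! t) \<in> parcs G ^^ (t - j)"
    using step[of 0 i] step[of j "t - j"] ij by auto
  then have "(w ! 0, w ! t) \<in> parcs G ^^ (i + m + (t - j))" using m by (blast intro: relpow_trans)
  moreover assume "\<not> j - i \<le> m"
  then have "i + m + (t - j) < t" using ij by simp
  ultimately show False using w unfolding geodesics_iff by blast
qed

section \<open>Arcs of the graph against geodesics of the line graph\<close>

context pair_graph
begin

interpretation L: pair_wf_digraph "line_graph G" by (rule pair_wf_digraph_line_graph)

lemma sym_parcs: "sym (parcs G)"
  by (auto intro: symI arcs_symmetric)

lemma irrefl_parcs: "irrefl (parcs G)"
  by (auto simp: irrefl_def dest: no_loops')

lemma edge_eqI:
  assumes "e \<in> edges G" "x \<in> e" "y \<in> e" "x \<noteq> y"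
  shows "e = {x, y}" "(x, y) \<in> parcs G"
  using assms by (auto simp: edges_def intro: arcs_symmetric)

lemma edge_otherE:
  assumes "e \<in> edges G" "x \<in> e"
  obtains y where "y \<in> e" "y \<noteq> x"
  using assms by (auto simp: edges_def dest: no_loops')

lemma nth_edge_walk_in_edges:
  assumes "p \<in> s_arcs G s" "i < s"
  shows "edge_walk p ! i \<in> edges G"
proof -
  have "length p = Suc s" "(p ! i, p ! Suc i) \<in> parcs G"
    using assms by (auto simp: s_arcs_iff nonbacktracking_def)
  then show ?thesis using assms(2) by (auto simp: edges_def)
qed

lemma edge_walk_adjacent:
  assumes "p \<in> s_arcs G s" "Suc i < s"
  shows "(edge_walk p ! i, edge_walk p ! Suc i) \<in> parcs (line_graph G)"
proof -
  have "length p = Suc s" "p ! i \<noteq> p ! Suc (Suc i)"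
    using assms by (auto simp: s_arcs_iff nonbacktracking_def)
  then show ?thesis
    using nth_edge_walk_in_edges[OF assms(1)] assms(2)
    by (auto simp: parcs_line_graph doubleton_eq_iff)
qed

text \<open>The first two edges determine the first vertex, because \<open>p ! 0\<close> and
  \<open>p ! 2\<close> differ; afterwards each edge determines the next vertex. A single edge would
  not reveal its direction, hence \<open>2 \<le> s\<close>.\<close>

lemma edge_walk_inj:
  assumes "p \<in> s_arcs G s" "q \<in> s_arcs G s" "2 \<le> s" "edge_walk p = edge_walk q"
  shows "p = q"
proof -
  have p: "length p = Suc s" "nonbacktracking (parcs G) s ((!) p)"
    and q: "length q = Suc s" "nonbacktracking (parcs G) s ((!) q)"
    using assms by (auto simp: s_arcs_iff)
  have edge: "{p ! i, p ! Suc i} = {q ! i, q ! Suc i}" if "i < s" for i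
    using nth_edge_walk[of i p] nth_edge_walk[of i q] assms(4) p(1) q(1) that by simp
  have "p ! 0 \<noteq> p ! 2" "q ! 0 \<noteq> q ! 2"
    using p(2) q(2) assms(3) unfolding nonbacktracking_def by (metis One_nat_def Suc_1 Suc_le_eq)+
  then have p0: "p ! 0 = q ! 0"
    using edge[of 0] edge[of 1] assms(3) by (auto simp: doubleton_eq_iff numeral_2_eq_2)
  have "p ! i = q ! i" if "i \<le> s" for i
    using that
  proof (induction i)
    case (Suc i)
    then show ?case using edge[of i] by (auto simp: doubleton_eq_iff)
  qed (rule p0)
  then show ?thesis using p(1) q(1) by (intro nth_equalityI) auto
qed

text \<open>The vertices shared by successive edges form the interior of the arc; the free ends of
  the first and last edge complete it.\<close>

lemma geodesic_imp_edge_walk: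
  assumes w: "w \<in> geodesics (line_graph G) t" and "1 \<le> t"
  shows "\<exists>p\<in>s_arcs G (Suc t). edge_walk p = w"
proof -
  have len: "length w = Suc t" using w by (simp add: L.geodesics_iff)
  have adj: "(w ! i, w ! Suc i) \<in> parcs (line_graph G)" if "i < t" for i
    using w that by (simp add: L.geodesics_iff)
  have edge: "w ! i \<in> edges G" if "i \<le> t" for i
    using adj[of i] adj[of "i - 1"] that \<open>1 \<le> t\<close> by (cases "i < t") (auto simp: parcs_line_graph)
  obtain c where c: "c i \<in> w ! i" "c i \<in> w ! Suc i" if "i < t" for i
  proof -
    have "\<exists>x. x \<in> w ! i \<and> x \<in> w ! Suc i" if "i < t" for i
      using adj[OF that] by (auto simp: parcs_line_graph)
    then show ?thesis using that by metis
  qed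
  \<comment> \<open>Otherwise the edges \<open>i\<close> and \<open>i + 2\<close> would meet, and
    their distance would be at most 1 instead of 2.\<close>
  have c_ne: "c i \<noteq> c (Suc i)" if "Suc i < t" for i
  proof
    assume "c i = c (Suc i)"
    then have "c i \<in> w ! i" "c i \<in> w ! Suc (Suc i)" using c(1)[of i] c(2)[of "Suc i"] that by auto
    moreover have "w ! i \<in> edges G" "w ! Suc (Suc i) \<in> edges G" using edge that by auto
    ultimately obtain j where "j \<le> 1" "(w ! i, w ! Suc (Suc i)) \<in> parcs (line_graph G) ^^ j"
      using edge_imp_relpow_le_1[of "w ! i" G "w ! Suc (Suc i)" "c i"] by blast
    then show False
      using L.geodesic_relpow_lower[OF w, of i "Suc (Suc i)" j] that by simp
  qed
  obtain a where a: "a \<in> w ! 0" "a \<noteq> c 0"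
    using edge_otherE[OF edge[of 0] c(1)] \<open>1 \<le> t\<close> by auto
  obtain b where b: "b \<in> w ! t" "b \<noteq> c (t - 1)"
    using edge_otherE[OF edge[of t], of "c (t - 1)"] c(2)[of "t - 1"] \<open>1 \<le> t\<close> by auto
  \<comment> \<open>The vertex sequence \<open>a, c 0, ..., c (t - 1), b\<close>, shifted by one
    against \<open>c\<close>, so that edge \<open>i\<close> of \<open>w\<close> joins
    \<open>v i\<close> to \<open>v (Suc i)\<close>.\<close>
  define v where "v k = (if k = 0 then a else if k \<le> t then c (k - 1) else b)" for k
  have v: "v i \<in> w ! i" "v (Suc i) \<in> w ! i" "v i \<noteq> v (Suc i)" if "i \<le> t" for i
  proof -
    consider "i = 0" | k where "i = Suc k" "i < t" | k where "i = Suc k" "i = t"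
      using \<open>i \<le> t\<close> by (metis not0_implies_Suc le_neq_implies_less)
    then have "v i \<in> w ! i \<and> v (Suc i) \<in> w ! i \<and> v i \<noteq> v (Suc i)"
    proof cases
      case 1
      then show ?thesis using a c(1)[of 0] \<open>1 \<le> t\<close> by (auto simp: v_def)
    next
      case 2
      then show ?thesis using c(2)[of k] c(1)[of i] c_ne[of k] by (auto simp: v_def)
    next
      case 3
      then show ?thesis using c(2)[of k] b by (auto simp: v_def)
    qed
    then show "v i \<in> w ! i" "v (Suc i) \<in> w ! i" "v i \<noteq> v (Suc i)" by blast+
  qed
  have weq: "w ! i = {v i, v (Suc i)}" and varc: "(v i, v (Suc i)) \<in> parcs G" if "i \<le> t" for i
    using edge_eqI[OF edge[OF that] v[OF that]] by auto
  \<comment> \<open>Equality would make two adjacent vertices of the line graph the same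
    edge.\<close>
  have "v i \<noteq> v (Suc (Suc i))" if "i < t" for i
    using adj[OF that] weq[of i] weq[of "Suc i"] that by (auto simp: parcs_line_graph)
  moreover define p where "p = map v [0..<Suc (Suc t)]"
  have pv: "length p = Suc (Suc t)" "\<And>i. i \<le> Suc t \<Longrightarrow> p ! i = v i"
    unfolding p_def by (simp, metis add_0 le_imp_less_Suc length_upt diff_zero nth_map nth_upt)
  ultimately have "p \<in> s_arcs G (Suc t)"
    using varc by (subst s_arcs_iff) (auto simp: nonbacktracking_def)
  moreover have "edge_walk p = w"
    using pv len weq by (intro nth_equalityI) auto
  ultimately show ?thesis by blast
qed

text \<open>A shortcut in the line graph projects to a short walk between an end of the first edge
  and an end of the last. Together with the piece of \<open>p\<close> between these ends it
  contradicts uniqueness of lengths below the girth.\<close>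

lemma edge_walk_geodesic:
  assumes p: "p \<in> s_arcs G s" and "2 \<le> s"
    and girth: "\<And>m h. 3 \<le> m \<Longrightarrow> cyclic_walk (parcs G) m h \<Longrightarrow> 2 * s \<le> m + 2"
  shows "edge_walk p \<in> geodesics (line_graph G) (s - 1)"
proof -
  have len: "length p = Suc s" and nb: "nonbacktracking (parcs G) s ((!) p)"
    using p \<open>2 \<le> s\<close> by (auto simp: s_arcs_iff)
  have edge: "edge_walk p ! i \<in> edges G" if "i < s" for i using nth_edge_walk_in_edges[OF p that] .
  have adj: "(edge_walk p ! i, edge_walk p ! Suc i) \<in> parcs (line_graph G)" if "i < s - 1" for i
    using edge_walk_adjacent[OF p] that by simp
  have "hd (edge_walk p) \<in> edges G"
    using edge[of 0] len \<open>2 \<le> s\<close> by (metis One_nat_def Suc_1 Suc_le_lessD diff_Suc_1 hd_conv_nth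
      length_0_conv length_edge_walk less_trans not_less_zero zero_less_Suc)
  moreover have "(edge_walk p ! 0, edge_walk p ! (s - 1)) \<notin> parcs (line_graph G) ^^ j"
    if j: "j < s - 1" for j
  proof
    assume *: "(edge_walk p ! 0, edge_walk p ! (s - 1)) \<in> parcs (line_graph G) ^^ j"
    \<comment> \<open>For \<open>s = 2\<close> both walks to be compared could have length 0, so
      this case is settled directly: the two edges are distinct.\<close>
    have "3 \<le> s"
    proof (rule ccontr)
      assume "\<not> 3 \<le> s"
      then have "s = 2" using \<open>2 \<le> s\<close> by simp
      then show False using * j adj[of 0] by (auto simp: parcs_line_graph)
    qed
    obtain u w m where m: "u \<in> edge_walk p ! 0" "w \<in> edge_walk p ! (s - 1)" "m \<le> j - 1"
      "(u, w) \<in> parcs G ^^ m"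
      using line_graph_relpow_lower[OF * edge sym_parcs] \<open>2 \<le> s\<close> by auto
    obtain n f where f: "n \<le> m" "nonbacktracking (parcs G) n f" "f 0 = u" "f n = w"
      using relpow_imp_nonbacktracking[OF m(4)] by blast
    obtain a where a: "a \<le> 1" "u = p ! a"
    proof -
      have "u = p ! 0 \<or> u = p ! 1" using m(1) len \<open>2 \<le> s\<close> by auto
      then show thesis using that[of 0] that[of 1] by auto
    qed
    obtain b where b: "s - 1 \<le> b" "b \<le> s" "w = p ! b"
    proof -
      have "w = p ! (s - 1) \<or> w = p ! s" using m(2) len \<open>2 \<le> s\<close> by auto
      then show thesis using that[of s] that[of "s - 1"] by auto
    qed
    have "a \<le> b" using a b \<open>3 \<le> s\<close> by simp
    have "nonbacktracking (parcs G) (b - a) (\<lambda>i. p ! (a + i))"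
      using nb b(2) unfolding nonbacktracking_def by auto
    \<comment> \<open>Here \<open>b - a\<close> is at most \<open>s\<close> and \<open>n\<close> at
      most \<open>s - 3\<close>, so a cycle of length at most \<open>b - a + n\<close> would be
      shorter than \<open>2 * s - 2\<close>.\<close>
    moreover have "\<not> cyclic_walk (parcs G) m' h" if "3 \<le> m'" "m' \<le> b - a + n" for m' h
      using girth[OF that(1), of h] that(2) \<open>3 \<le> s\<close> b(2) f(1) m(3) j by fastforce
    ultimately have "b - a = n"
      using nonbacktracking_length_unique[OF sym_parcs irrefl_parcs _ f(2), of "b - a" "\<lambda>i. p ! (a + i)"]
        f(3,4) a(2) b(3) \<open>a \<le> b\<close> by simp
    \<comment> \<open>The piece of \<open>p\<close> has length at least \<open>s - 2\<close>, the
      other walk at most \<open>s - 3\<close>.\<close>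
    then show False using a(1) b(1) f(1) m(3) j \<open>3 \<le> s\<close> by simp
  qed
  ultimately show ?thesis using len adj \<open>2 \<le> s\<close> by (simp add: L.geodesics_iff)
qed

text \<open>The arc winds around the cycle. Past half of it, going round the other way reaches the
  same edge in fewer steps.\<close>

lemma cyclic_walk_imp_edge_walk_not_geodesic:
  assumes f: "cyclic_walk (parcs G) n f" and "3 \<le> n" "2 \<le> s" "n + 2 < 2 * s"
  shows "\<exists>p\<in>s_arcs G s. edge_walk p \<notin> geodesics (line_graph G) (s - 1)"
proof -
  define c where "c i = f (i mod n)" for i
  have arc: "(c i, c (Suc i)) \<in> parcs G" for i
  proof -
    have "i mod n < n" using \<open>3 \<le> n\<close> by simp
    then have "(f (i mod n), f (Suc (i mod n))) \<in> parcs G" "f n = f 0"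
      using f unfolding cyclic_walk_def by auto
    then show ?thesis by (auto simp: c_def mod_Suc)
  qed
  have ne: "c i \<noteq> c (Suc (Suc i))" for i
  proof
    assume "c i = c (Suc (Suc i))"
    then have "i mod n = Suc (Suc i) mod n"
      using f \<open>3 \<le> n\<close> unfolding c_def cyclic_walk_def by (auto dest!: inj_onD)
    then have "n dvd Suc (Suc i) - i" using mod_eq_dvd_iff_nat[of i "Suc (Suc i)" n] by simp
    then have "n dvd 2" by (simp add: numeral_2_eq_2)
    then show False using \<open>3 \<le> n\<close> by (auto dest: dvd_imp_le)
  qed
  define p where "p = map c [0..<Suc s]"
  have p_nth: "p ! i = c i" if "i \<le> s" for i
    using that unfolding p_def by (metis add_0 le_imp_less_Suc length_upt diff_zero nth_map nth_upt)
  have len: "length p = Suc s" by (simp add: p_def)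
  have p: "p \<in> s_arcs G s"
    using \<open>2 \<le> s\<close> arc ne len p_nth by (subst s_arcs_iff) (auto simp: nonbacktracking_def)
  define e where "e i = {c i, c (Suc i)}" for i
  have edge: "e i \<in> edges G" and adj: "(e i, e (Suc i)) \<in> parcs (line_graph G)" for i
    using arc[of i] arc[of "Suc i"] ne[of i]
    by (auto simp: parcs_line_graph e_def edges_def doubleton_eq_iff)
  have walk: "(e i, e (i + k)) \<in> parcs (line_graph G) ^^ k" for i k
    using adj unfolding relpow_fun_conv by (intro exI[of _ "\<lambda>j. e (i + j)"]) simp
  have backward: "(e (i + k), e i) \<in> parcs (line_graph G) ^^ k" for i k
  proof (induction k)
    case (Suc k)
    have "(e (Suc (i + k)), e (i + k)) \<in> parcs (line_graph G)"
      using adj[of "i + k"] by (auto simp: parcs_line_graph)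
    then show ?case using Suc by (metis add_Suc_right relpow_Suc_I2)
  qed simp
  have "e n = e 0" by (simp add: e_def c_def mod_Suc)
  \<comment> \<open>The edge \<open>e m\<close> is \<open>m\<close> steps ahead but
    \<open>n - m\<close> steps backwards from \<open>e 0\<close>, and \<open>n < 2 * m\<close> makes
    the detour backwards shorter. The cap at \<open>n\<close> covers arcs that go round more than
    once.\<close>
  define m where "m = min n (s - 1)"
  have m: "m \<le> n" "m \<le> s - 1" "n < 2 * m" using assms(2-4) by (auto simp: m_def)
  have "(e 0, e m) \<in> parcs (line_graph G) ^^ (n - m)"
    using backward[of m "n - m"] m(1) \<open>e n = e 0\<close> by simp
  then have short: "(e 0, e (s - 1)) \<in> parcs (line_graph G) ^^ (n - m + (s - 1 - m))"
    using walk[of m "s - 1 - m"] m(2) by (metis le_add_diff_inverse relpow_trans)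
  have e: "edge_walk p ! i = e i" if "i < s" for i using that len p_nth by (simp add: e_def)
  have "edge_walk p \<notin> geodesics (line_graph G) (s - 1)"
    using short m \<open>2 \<le> s\<close> e[of 0] e[of "s - 1"] unfolding L.geodesics_iff by auto
  then show ?thesis using p by blast
qed

lemma line_graph_connected:
  assumes "Digraph_Component.connected (with_proj G)" "e \<in> edges G" "f \<in> edges G"
  shows "\<exists>n. (e, f) \<in> parcs (line_graph G) ^^ n"
proof -
  obtain u w where uw: "u \<in> e" "w \<in> f" "u \<in> pverts G" "w \<in> pverts G"
    using assms(2,3) by (auto simp: edges_def dest: in_arcsD1 in_arcsD2)
  then have "u \<rightarrow>\<^sup>*\<^bsub>with_proj (mk_symmetric (with_proj G))\<^esub> w"
    using assms(1) by (simp add: connected_def strongly_connected_def)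
  then have "u \<rightarrow>\<^sup>*\<^bsub>with_proj G\<^esub> w" using reachable_mk_symmetric_eq[OF sym_arcs] by blast
  then obtain p where "awalk u p w" by (auto simp: reachable_awalk)
  then have "(u, w) \<in> parcs G ^^ length p" using awalk_length_iff_relpow[of u w "length p"] by blast
  from line_graph_relpow_upper[OF this assms(2,3) uw(1,2)] show ?thesis by blast
qed

text \<open>Some two edges are more than \<open>s - 2\<close> apart, by the bound on the diameter; a
  shortest walk between them exists by connectedness, and its first \<open>s - 1\<close> steps are a
  geodesic. This rules out that transitivity on geodesics holds vacuously.\<close>

lemma line_graph_geodesics_nonempty:
  assumes conn: "Digraph_Component.connected (with_proj G)"
    and "2 \<le> s" and diam: "ereal s \<le> diam (line_graph G) + 1"
  shows "geodesics (line_graph G) (s - 1) \<noteq> {}"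
proof -
  have "\<exists>e\<in>edges G. \<exists>f\<in>edges G. \<not> gdist (line_graph G) e f \<le> ereal (real (s - 2))"
  proof (rule ccontr)
    assume "\<not> ?thesis"
    then have "diam (line_graph G) \<le> ereal (real (s - 2))"
      unfolding diam_def by (intro SUP_least) auto
    then have "diam (line_graph G) + 1 \<le> ereal (real (s - 2)) + 1" by (rule add_right_mono)
    then have "ereal s \<le> ereal (real (s - 2)) + 1" using diam by (rule order_trans[rotated])
    then show False using \<open>2 \<le> s\<close> by (simp add: one_ereal_def)
  qed
  then obtain e f where ef: "e \<in> edges G" "f \<in> edges G"
    and far: "\<And>m. m \<le> s - 2 \<Longrightarrow> (e, f) \<notin> parcs (line_graph G) ^^ m"
    using L.gdist_le_iff[of _ _ "s - 2"] by auto
  define n where "n = (LEAST n. (e, f) \<in> parcs (line_graph G) ^^ n)"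
  have n: "(e, f) \<in> parcs (line_graph G) ^^ n"
    unfolding n_def using line_graph_connected[OF conn ef] by (rule LeastI_ex)
  have least: "n \<le> m" if "(e, f) \<in> parcs (line_graph G) ^^ m" for m
    unfolding n_def using that by (rule Least_le)
  have "s - 1 \<le> n" using far[of n] n by fastforce
  obtain h where h: "h 0 = e" "h n = f" "\<And>i. i < n \<Longrightarrow> (h i, h (Suc i)) \<in> parcs (line_graph G)"
    using n unfolding relpow_fun_conv by blast
  \<comment> \<open>The remainder of the shortest walk: joined to a shortcut from \<open>e\<close>
    to \<open>h (s - 1)\<close>, it would connect \<open>e\<close> to \<open>f\<close> in fewer than
    \<open>n\<close> steps.\<close>
  have tail: "(h (s - 1), f) \<in> parcs (line_graph G) ^^ (n - (s - 1))"
    unfolding relpow_fun_conv using h \<open>s - 1 \<le> n\<close>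
    by (intro exI[of _ "\<lambda>i. h (s - 1 + i)"]) auto
  define w where "w = map h [0..<Suc (s - 1)]"
  have w_nth: "w ! i = h i" if "i \<le> s - 1" for i
    using that unfolding w_def by (metis add_0 le_imp_less_Suc length_upt diff_zero nth_map nth_upt)
  have "(h 0, h (s - 1)) \<notin> parcs (line_graph G) ^^ m" if "m < s - 1" for m
  proof
    assume "(h 0, h (s - 1)) \<in> parcs (line_graph G) ^^ m"
    then have "(e, f) \<in> parcs (line_graph G) ^^ (m + (n - (s - 1)))"
      using tail h(1) by (auto intro: relpow_trans)
    then show False using least \<open>s - 1 \<le> n\<close> that by fastforce
  qed
  moreover have "length w = Suc (s - 1)" "hd w = e" using h(1) by (simp_all add: w_def hd_map del: upt_Suc)
  ultimately have "w \<in> geodesics (line_graph G) (s - 1)"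
    using ef(1) h(3) \<open>s - 1 \<le> n\<close> w_nth unfolding L.geodesics_iff by auto
  then show ?thesis by blast
qed

end

section \<open>Cycles and the girth\<close>

lemma pcas_append: "pcas u (p @ q) v \<longleftrightarrow> (\<exists>w. pcas u p w \<and> pcas w q v)"
  by (induction p arbitrary: u) auto

text \<open>Cycles are arc lists whose vertex list is distinct after removal of its head, that is on
  the indices \<open>1\<close> to \<open>n\<close>, whereas \<open>cyclic_walk\<close> asks for
  distinctness on \<open>0\<close> to \<open>n - 1\<close>. The equation \<open>f n = f 0\<close>
  translates between the two.\<close>

lemma (in pair_wf_digraph) cycle_length_iff:
  assumes "0 < n"
  shows "(\<exists>p. cycle p \<and> length p = n) \<longleftrightarrow> (\<exists>f. cyclic_walk (parcs G) n f)"
proof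
  assume "\<exists>p. cycle p \<and> length p = n"
  then obtain u p where p: "awalk u p u" "distinct (tl (awalk_verts u p))" "p \<noteq> []" "length p = n"
    unfolding cycle_def by blast
  define f where "f i = awalk_verts u p ! i" for i
  have cas: "cas u p u" and arcs: "set p \<subseteq> parcs G" using p(1) by auto
  have f_fst: "f i = fst (p ! i)" if "i < n" for i
    using that p(3,4) by (simp add: f_def awalk_verts_conv nth_append)
  have f_snd: "f (Suc i) = snd (p ! i)" if "i < n" for i
    using that p(3,4) by (simp add: f_def awalk_verts_conv'[OF cas])
  have "(f i, f (Suc i)) \<in> parcs G" if "i < n" for i
    using arcs nth_mem[of i p] that p(4) by (auto simp: f_fst f_snd)
  moreover have "f n = f 0"
  proof -
    have "f 0 = u" using p(3) cas by (cases p) (auto simp: f_def)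
    moreover have "f n = last (awalk_verts u p)"
      using p(4) by (simp add: f_def last_conv_nth length_awalk_verts)
    ultimately show ?thesis using p(1) by auto
  qed
  moreover have "inj_on f {..<n}"
  proof -
    have tl: "f (Suc i) \<noteq> f (Suc j)" if "i < n" "j < n" "i \<noteq> j" for i j
      using p(2) that p(4) by (auto simp: f_def distinct_conv_nth nth_tl length_awalk_verts)
    have "f i \<noteq> f j" if "i < j" "j < n" for i j
    proof (cases i)
      case 0
      \<comment> \<open>Index \<open>0\<close> lies outside the tail of the vertex list and is
        traded for index \<open>n\<close>.\<close>
      have "j - 1 < n" "n - 1 < n" "j - 1 \<noteq> n - 1" "Suc (j - 1) = j" "Suc (n - 1) = n"
        using that by linarith+
      then show ?thesis using tl[of "j - 1" "n - 1"] 0 \<open>f n = f 0\<close> by metis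
    next
      case (Suc k)
      then show ?thesis using tl[of k "j - 1"] that by auto
    qed
    then show ?thesis by (intro inj_onI) (metis lessThan_iff linorder_neqE_nat)
  qed
  ultimately show "\<exists>f. cyclic_walk (parcs G) n f" unfolding cyclic_walk_def by blast
next
  assume "\<exists>f. cyclic_walk (parcs G) n f"
  then obtain f where f: "f n = f 0" "inj_on f {..<n}" "\<And>i. i < n \<Longrightarrow> (f i, f (Suc i)) \<in> parcs G"
    unfolding cyclic_walk_def by blast
  define p where "p = map (\<lambda>i. (f i, f (Suc i))) [0..<n]"
  \<comment> \<open>Stated for every prefix length \<open>m\<close>, with endpoint
    \<open>f m\<close>, so that induction applies.\<close>
  have cas: "cas (f 0) (map (\<lambda>i. (f i, f (Suc i))) [0..<m]) (f m)" for m
    by (induction m) (auto simp: pcas_append simp del: cas_append_iff)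
  have "p \<noteq> []" "length p = n" using assms by (simp_all add: p_def)
  moreover have "set p \<subseteq> parcs G" using f(3) by (auto simp: p_def)
  moreover have "f 0 \<in> pverts G" using f(3)[OF assms] by (rule in_arcsD1)
  ultimately have "awalk (f 0) p (f 0)" using cas[of n] f(1) by (simp add: awalk_def p_def)
  moreover have "distinct (tl (awalk_verts (f 0) p))"
  proof -
    have "inj_on (\<lambda>i. f (Suc i)) {0..<n}"
    proof (rule inj_onI)
      \<comment> \<open>Reduction modulo \<open>n\<close> moves the index \<open>n\<close> to
        \<open>0\<close>, back into the range where \<open>f\<close> is injective.\<close>
      have red: "f (Suc i) = f (Suc i mod n)" if "i < n" for i
        using that f(1) by (cases "Suc i = n") auto
      fix i j assume ij: "i \<in> {0..<n}" "j \<in> {0..<n}" "f (Suc i) = f (Suc j)"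
      then have "f (Suc i mod n) = f (Suc j mod n)" using red by auto
      then have "Suc i mod n = Suc j mod n" using f(2) assms by (auto dest!: inj_onD)
      then show "i = j" using ij(1,2) by (cases "Suc i = n"; cases "Suc j = n") auto
    qed
    moreover have "tl (awalk_verts (f 0) p) = map (\<lambda>i. f (Suc i)) [0..<n]"
      using \<open>awalk (f 0) p (f 0)\<close> \<open>p \<noteq> []\<close> awalk_verts_conv'[of "f 0" p "f 0"]
      by (auto simp: p_def)
    ultimately show ?thesis by (simp add: distinct_map)
  qed
  ultimately have "cycle p" using \<open>p \<noteq> []\<close> unfolding cycle_def by blast
  then show "\<exists>p. cycle p \<and> length p = n" using \<open>length p = n\<close> by blast
qed

text \<open>The bound amounts to \<open>2 * s - 2\<close> being at most the girth, hence at most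
  every cycle length; in a forest both sides hold. Writing \<open>m + 2\<close> on the right avoids
  truncated subtraction.\<close>

lemma (in pair_wf_digraph) le_half_girth_iff:
  fixes s :: nat
  shows "ereal s \<le> girth G / 2 + 1 \<longleftrightarrow> (\<forall>m h. 3 \<le> m \<longrightarrow> cyclic_walk (parcs G) m h \<longrightarrow> 2 * s \<le> m + 2)"
proof -
  have "ereal s \<le> girth G / 2 + 1 \<longleftrightarrow> ereal (2 * real s - 2) \<le> girth G"
    by (cases "girth G") (auto simp: one_ereal_def)
  also have "\<dots> \<longleftrightarrow> (\<forall>p. cycle p \<longrightarrow> 3 \<le> length p \<longrightarrow> 2 * real s - 2 \<le> real (length p))"
    unfolding girth_def le_INF_iff by auto
  also have "\<dots> \<longleftrightarrow> (\<forall>p. cycle p \<longrightarrow> 3 \<le> length p \<longrightarrow> 2 * s \<le> length p + 2)"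
  proof -
    have "2 * real s - 2 \<le> real m \<longleftrightarrow> 2 * s \<le> m + 2" for m by linarith
    then show ?thesis by simp
  qed
  also have "\<dots> \<longleftrightarrow> (\<forall>m. 3 \<le> m \<longrightarrow> (\<exists>p. cycle p \<and> length p = m) \<longrightarrow> 2 * s \<le> m + 2)"
    by blast
  also have "\<dots> \<longleftrightarrow> (\<forall>m. 3 \<le> m \<longrightarrow> (\<exists>f. cyclic_walk (parcs G) m f) \<longrightarrow> 2 * s \<le> m + 2)"
    by (simp add: cycle_length_iff)
  finally show ?thesis by blast
qed


section \<open>Automorphisms acting on arcs and on line graph geodesics\<close>

context pair_graph
begin

interpretation L: pair_wf_digraph "line_graph G" by (rule pair_wf_digraph_line_graph)

lemma edge_subset_pverts: "e \<in> edges G \<Longrightarrow> e \<subseteq> pverts G"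
  by (auto simp: edges_def dest: in_arcsD1 in_arcsD2)

lemma set_s_arcs: "p \<in> s_arcs G s \<Longrightarrow> set p \<subseteq> pverts G"
  by (auto simp: s_arcs_def vwalk_def)

lemma set_line_geodesics: "w \<in> geodesics (line_graph G) t \<Longrightarrow> set w \<subseteq> edges G"
  by (auto simp: geodesics_def vwalk_def)

lemma aut_inj_on:
  assumes "g \<in> carrier (aut_group G)"
  shows "inj_on g (pverts G)"
  using assms by (simp add: carrier_aut_group Bij_def bij_betw_def)

lemma aut_map_s_arcs:
  assumes g: "g \<in> carrier (aut_group G)" and p: "p \<in> s_arcs G s" and "1 \<le> s"
  shows "map g p \<in> s_arcs G s"
proof -
  have len: "length p = Suc s" and nb: "nonbacktracking (parcs G) s ((!) p)"
    using p \<open>1 \<le> s\<close> by (auto simp: s_arcs_iff)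
  have V: "p ! i \<in> pverts G" if "i \<le> s" for i
    using set_s_arcs[OF p] nth_mem[of i p] that len by auto
  have "(g (p ! i), g (p ! Suc i)) \<in> parcs G" if "i < s" for i
    using g nb V[of i] V[of "Suc i"] that by (simp add: carrier_aut_group nonbacktracking_def)
  moreover have "g (p ! i) \<noteq> g (p ! Suc (Suc i))" if "Suc i < s" for i
    using inj_onD[OF aut_inj_on[OF g], of "p ! i" "p ! Suc (Suc i)"] V[of i] V[of "Suc (Suc i)"]
      nb that unfolding nonbacktracking_def by auto
  ultimately show ?thesis
    using \<open>1 \<le> s\<close> len by (simp add: s_arcs_iff nonbacktracking_def)
qed

lemma aut_image_edge:
  assumes "g \<in> carrier (aut_group G)" "e \<in> edges G"
  shows "g ` e \<in> edges G"
proof -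
  obtain u v where uv: "e = {u, v}" "(u, v) \<in> parcs G" using assms(2) by (auto simp: edges_def)
  then have "(g u, g v) \<in> parcs G"
    using assms(1) by (auto simp: carrier_aut_group dest: in_arcsD1 in_arcsD2)
  then show ?thesis using uv(1) by (auto simp: edges_def)
qed

lemma aut_image_adjacent:
  assumes g: "g \<in> carrier (aut_group G)" and ef: "(e, f) \<in> parcs (line_graph G)"
  shows "(g ` e, g ` f) \<in> parcs (line_graph G)"
proof -
  have "g ` e \<noteq> g ` f"
    using inj_on_image_eq_iff[OF aut_inj_on[OF g], of e f] ef edge_subset_pverts
    by (simp add: parcs_line_graph)
  then show ?thesis using ef aut_image_edge[OF g] by (auto simp: parcs_line_graph)
qed

lemma aut_image_relpow:
  assumes g: "g \<in> carrier (aut_group G)" and "(e, f) \<in> parcs (line_graph G) ^^ m"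
  shows "(g ` e, g ` f) \<in> parcs (line_graph G) ^^ m"
  using assms(2)
proof (induction m arbitrary: f)
  case (Suc m)
  then show ?case by (auto intro: aut_image_adjacent[OF g])
qed simp

text \<open>A shortcut between the ends of the image would be mapped by the inverse automorphism
  \<open>h\<close> to a shortcut between the ends of \<open>w\<close>.\<close>

lemma aut_map_line_geodesics:
  assumes g: "g \<in> carrier (aut_group G)" and w: "w \<in> geodesics (line_graph G) t"
  shows "map ((`) g) w \<in> geodesics (line_graph G) t"
proof -
  obtain h where h: "h \<in> carrier (aut_group G)" "\<And>v. v \<in> pverts G \<Longrightarrow> h (g v) = v"
    using aut_inverse[OF g] by blast
  have len: "length w = Suc t" using w by (simp add: L.geodesics_iff)
  have "h ` g ` e = e" if "e \<in> set w" for e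
    using h(2) edge_subset_pverts set_line_geodesics[OF w] that
    by (force simp: image_image)
  then have inv: "h ` g ` (w ! i) = w ! i" if "i \<le> t" for i using that len by simp
  have "(g ` (w ! 0), g ` (w ! t)) \<notin> parcs (line_graph G) ^^ m" if "m < t" for m
    using aut_image_relpow[OF h(1), of "g ` (w ! 0)" "g ` (w ! t)" m] inv[of 0] inv[of t] w that
    by (auto simp: L.geodesics_iff)
  moreover have "(g ` (w ! i), g ` (w ! Suc i)) \<in> parcs (line_graph G)" if "i < t" for i
    using aut_image_adjacent[OF g] w that by (simp add: L.geodesics_iff)
  moreover have "hd (map ((`) g) w) \<in> edges G"
    using aut_image_edge[OF g] w by (cases w) (auto simp: L.geodesics_iff)
  ultimately show ?thesis using len by (simp add: L.geodesics_iff)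
qed

lemma arc_transitive_iff:
  assumes "subgroup H (aut_group G)" "1 \<le> s"
  shows "arc_transitive G H s \<longleftrightarrow> (\<forall>p\<in>s_arcs G s. \<forall>q\<in>s_arcs G s. \<exists>g\<in>H. map g p = q)"
  unfolding arc_transitive_def
proof (rule transitive_aut_action_iff[OF assms(1)])
  fix g h p
  assume "p \<in> s_arcs G s"
  then have V: "v \<in> pverts G" if "v \<in> set p" for v using set_s_arcs that by blast
  show "map (compose (pverts G) g h) p = map g (map h p)" using V by (auto simp: compose_eq)
  show "map (\<lambda>v\<in>pverts G. v) p = p" using V by (auto intro: map_idI)
qed (use aut_map_s_arcs assms(2) in blast)

lemma line_geodesic_transitive_iff:
  assumes "subgroup H (aut_group G)"
  shows "line_geodesic_transitive G H t \<longleftrightarrow>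
    (\<forall>w\<in>geodesics (line_graph G) t. \<forall>w'\<in>geodesics (line_graph G) t. \<exists>g\<in>H. map ((`) g) w = w')"
  unfolding line_geodesic_transitive_def
proof (rule transitive_aut_action_iff[OF assms(1)])
  fix g h w
  assume "w \<in> geodesics (line_graph G) t"
  then have V: "v \<in> pverts G" if "e \<in> set w" "v \<in> e" for e v
    using set_line_geodesics edge_subset_pverts that by blast
  show "map ((`) (compose (pverts G) g h)) w = map ((`) g) (map ((`) h) w)"
    using V by (auto simp: compose_eq image_image intro!: image_cong)
  show "map ((`) (\<lambda>v\<in>pverts G. v)) w = w"
  proof (rule map_idI)
    fix e assume "e \<in> set w"
    then have "(\<lambda>v\<in>pverts G. v) ` e = id ` e" using V by (intro image_cong) auto
    then show "(\<lambda>v\<in>pverts G. v) ` e = e" by simp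
  qed
qed (use aut_map_line_geodesics in blast)

section \<open>Equivalence of the two transitivity conditions\<close>

theorem arc_transitive_iff_line_geodesic_transitive:
  assumes conn: "Digraph_Component.connected (with_proj G)" and H: "subgroup H (aut_group G)"
    and s: "2 \<le> s" and diam: "ereal s \<le> diam (line_graph G) + 1"
  shows "arc_transitive G H s \<longleftrightarrow>
    ereal s \<le> girth G / 2 + 1 \<and> line_geodesic_transitive G H (s - 1)"
proof -
  let ?A = "s_arcs G s" and ?L = "geodesics (line_graph G) (s - 1)"
  have "1 \<le> s" "Suc (s - 1) = s" using s by simp_all
  have lift: "\<exists>p\<in>?A. edge_walk p = w" if "w \<in> ?L" for w
    using geodesic_imp_edge_walk[OF that] s by simp
  have sub: "g \<in> carrier (aut_group G)" if "g \<in> H" for g using H that by (rule subgroup.mem_carrier)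
  show ?thesis
    unfolding arc_transitive_iff[OF H \<open>1 \<le> s\<close>] line_geodesic_transitive_iff[OF H]
  proof (intro iffI conjI)
    assume trans: "\<forall>p\<in>?A. \<forall>q\<in>?A. \<exists>g\<in>H. map g p = q"
    show "ereal s \<le> girth G / 2 + 1"
    proof (rule ccontr)
      assume "\<not> ?thesis"
      then obtain m f where f: "3 \<le> m" "cyclic_walk (parcs G) m f" "m + 2 < 2 * s"
        unfolding le_half_girth_iff by (auto simp: not_le)
      \<comment> \<open>Two arcs that no automorphism can interchange: the edge sequence of
        \<open>q\<close> is not a geodesic, that of \<open>p\<close> below is the geodesic
        \<open>w\<close>.\<close>
      obtain q where q: "q \<in> ?A" "edge_walk q \<notin> ?L"
        using cyclic_walk_imp_edge_walk_not_geodesic[OF f(2,1) s f(3)] by blast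
      obtain w where w: "w \<in> ?L" using line_graph_geodesics_nonempty[OF conn s diam] by blast
      obtain p where p: "p \<in> ?A" "edge_walk p = w" using lift[OF w] by blast
      obtain g where g: "g \<in> H" "map g p = q" using trans p(1) q(1) by blast
      then have "edge_walk q \<in> ?L"
        using aut_map_line_geodesics[OF sub[OF g(1)] w] p(2) edge_walk_map by metis
      then show False using q(2) by contradiction
    qed
    show "\<forall>w\<in>?L. \<forall>w'\<in>?L. \<exists>g\<in>H. map ((`) g) w = w'"
    proof (intro ballI)
      fix w w' assume w: "w \<in> ?L" "w' \<in> ?L"
      obtain p where p: "p \<in> ?A" "edge_walk p = w" using lift[OF w(1)] by blast
      obtain q where q: "q \<in> ?A" "edge_walk q = w'" using lift[OF w(2)] by blast
      obtain g where "g \<in> H" "map g p = q" using trans p(1) q(1) by blast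
      then show "\<exists>g\<in>H. map ((`) g) w = w'" using edge_walk_map[of g p] p(2) q(2) by auto
    qed
  next
    assume *: "ereal s \<le> girth G / 2 + 1 \<and> (\<forall>w\<in>?L. \<forall>w'\<in>?L. \<exists>g\<in>H. map ((`) g) w = w')"
    then have girth: "2 * s \<le> m + 2" if "3 \<le> m" "cyclic_walk (parcs G) m h" for m h
      using that unfolding le_half_girth_iff by blast
    show "\<forall>p\<in>?A. \<forall>q\<in>?A. \<exists>g\<in>H. map g p = q"
    proof (intro ballI)
      fix p q assume p: "p \<in> ?A" and q: "q \<in> ?A"
      have "edge_walk p \<in> ?L" "edge_walk q \<in> ?L" using edge_walk_geodesic s girth p q by blast+
      then obtain g where g: "g \<in> H" "map ((`) g) (edge_walk p) = edge_walk q" using * by blast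
      \<comment> \<open>The element \<open>g\<close> is only known to match the edge sequences;
        injectivity of \<open>edge_walk\<close> on arcs lifts this to the arcs themselves.\<close>
      have "map g p = q"
        using edge_walk_inj[OF aut_map_s_arcs[OF sub[OF g(1)] p \<open>1 \<le> s\<close>] q s] g(2)
        by (simp add: edge_walk_map)
      then show "\<exists>g\<in>H. map g p = q" using g(1) by blast
    qed
  qed
qed

end

theorem theorem1p3:
  fixes \<Gamma> :: "'a pair_pre_digraph" and G :: "('a \<Rightarrow> 'a) set" and k s :: nat
  assumes "pair_graph \<Gamma>"
    and "Digraph_Component.connected (with_proj \<Gamma>)"
    and "regular \<Gamma> k" and "k \<ge> 3"
    and "\<not> complete_digraph (card (pverts \<Gamma>)) (with_proj \<Gamma>)"
    and "subgroup G (aut_group \<Gamma>)"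
    and "2 \<le> s" and "ereal s \<le> diam (line_graph \<Gamma>) + 1"
  shows "arc_transitive \<Gamma> G s \<longleftrightarrow>
    ereal s \<le> girth \<Gamma> / 2 + 1 \<and> line_geodesic_transitive \<Gamma> G (s - 1)"
  using assms by (intro pair_graph.arc_transitive_iff_line_geodesic_transitive)

end
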